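(* Let $D$ be a digraph obtained from a tournament by deleting the edges of $2$ disjoint stars, and let $\Delta$ be the dependency digraph of $D$. If $\Delta$ has neither a source nor a sink and $D$ has no sink, then $D$ has at least two vertices with the second neighborhood property, that is, there are at least two distinct vertices $v\in V(D)$ with $d^+_D(v)\le d^{++}_D(v)$.
   Context: All digraphs are finite. A tournament is a digraph without loops in which every two distinct vertices are joined by exactly one arc. Write $x\rightarrow y$ if $(x,y)$ is an arc. $N^+(v)$ is the set of out-neighbors of $v$ and $N^{++}(v)$ is the set of vertices at distance exactly $2$ from $v$ (reached from $v$ by a directed path of length 2 but not by one of length 0 or 1); $d^+(v)=|N^+(v)|$, $d^{++}(v)=|N^{++}(v)|$. In any digraph, a sink is a vertex of out-degree $0$ and a source is a vertex of in-degree $0$. For distinct vertices $x,y$ of $D$, $xy$ is a missing edge if neither $(x,y)$ nor $(y,x)$ is an arc of $D$. A star of center $x$ is a graph whose edge set has the form $\{a_ix : i=1,\dots,k\}$ with $k\ge 1$, the $a_i$ distinct and different from $x$. Stars are disjoint if they share no vertex. Deleting the edges of the stars from a tournament means removing the arc joining the two endpoints of each star edge; thus the missing edges of $D$ are exactly the edges of the two stars. Dependency digraph: for missing edges $e$ and $e'$ of $D$, $e$ loses to $e'$ if the endpoints can be named $e=x_1y_1$, $e'=x_2y_2$ so that $x_1\rightarrow x_2$, $y_2\notin N^+(x_1)\cup N^{++}(x_1)$, $y_1\rightarrow y_2$ and $x_2\notin N^+(y_1)\cup N^{++}(y_1)$. The dependency digraph $\Delta$ of $D$ has the missing edges of $D$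 as vertices, and an arc $(e,e')$ whenever $e$ loses to $e'$ (digons in $\Delta$ are allowed). *)

theory Defs
  imports "Graph_Theory.Pair_Digraph"
begin

definition is_sink :: "'a pair_pre_digraph \<Rightarrow> 'a \<Rightarrow> bool" where
  "is_sink G v \<longleftrightarrow> v \<in> pverts G \<and> out_degree (with_proj G) v = 0"

definition is_source :: "'a pair_pre_digraph \<Rightarrow> 'a \<Rightarrow> bool" where
  "is_source G v \<longleftrightarrow> v \<in> pverts G \<and> in_degree (with_proj G) v = 0"

text \<open>The locale \<open>pair_digraph\<close> provides finiteness and the absence of loops.\<close>
definition tournament :: "'a pair_pre_digraph \<Rightarrow> bool" where
  "tournament T \<longleftrightarrow> pair_digraph T \<and>
     (\<forall>u \<in> pverts T. \<forall>v \<in> pverts T. u \<noteq> v \<longrightarrow> ((u, v) \<in> parcs T \<longleftrightarrow> (v, u) \<notin> parcs T))"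

definition out_nbrs :: "'a pair_pre_digraph \<Rightarrow> 'a \<Rightarrow> 'a set" where
  "out_nbrs G v = {u. (v, u) \<in> parcs G}"

definition second_out_nbrs :: "'a pair_pre_digraph \<Rightarrow> 'a \<Rightarrow> 'a set" where
  "second_out_nbrs G v =
     {u. (\<exists>w. (v, w) \<in> parcs G \<and> (w, u) \<in> parcs G) \<and> u \<noteq> v \<and> (v, u) \<notin> parcs G}"

definition second_nbhd_property :: "'a pair_pre_digraph \<Rightarrow> 'a \<Rightarrow> bool" where
  "second_nbhd_property G v \<longleftrightarrow> card (out_nbrs G v) \<le> card (second_out_nbrs G v)"

text \<open>An undirected edge is a two-element set of vertices. A star has no isolated vertices, so it
  is represented by its edge set \<open>S\<close>, and its vertex set is \<open>\<Union>S\<close>.\<close>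
definition star :: "'a \<Rightarrow> 'a set set \<Rightarrow> bool" where
  "star x S \<longleftrightarrow> (\<exists>A. finite A \<and> A \<noteq> {} \<and> x \<notin> A \<and> S = (\<lambda>a. {a, x}) ` A)"

definition delete_edges :: "'a pair_pre_digraph \<Rightarrow> 'a set set \<Rightarrow> 'a pair_pre_digraph" where
  "delete_edges G E = \<lparr> pverts = pverts G, parcs = {(u, v) \<in> parcs G. {u, v} \<notin> E} \<rparr>"

definition missing_edges :: "'a pair_pre_digraph \<Rightarrow> 'a set set" where
  "missing_edges G = {{x, y} | x y. x \<in> pverts G \<and> y \<in> pverts G \<and> x \<noteq> y \<and>
     (x, y) \<notin> parcs G \<and> (y, x) \<notin> parcs G}"

definition loses_to :: "'a pair_pre_digraph \<Rightarrow> 'a set \<Rightarrow> 'a set \<Rightarrow> bool" where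
  "loses_to G e e' \<longleftrightarrow> (\<exists>x1 y1 x2 y2. e = {x1, y1} \<and> e' = {x2, y2} \<and>
     (x1, x2) \<in> parcs G \<and> y2 \<notin> out_nbrs G x1 \<union> second_out_nbrs G x1 \<and>
     (y1, y2) \<in> parcs G \<and> x2 \<notin> out_nbrs G y1 \<union> second_out_nbrs G y1)"

definition dependency_digraph :: "'a pair_pre_digraph \<Rightarrow> 'a set pair_pre_digraph" where
  "dependency_digraph G = \<lparr> pverts = missing_edges G,
     parcs = {(e, e'). e \<in> missing_edges G \<and> e' \<in> missing_edges G \<and> loses_to G e e'} \<rparr>"

end

theory Submission
  imports Defs
begin

text \<open>
  Say \<open>x \<rightarrow> y\<close> for the centers, and let \<open>A\<close>, \<open>B\<close> be the leaves of \<open>x\<close>, \<open>y\<close>. Edges of the same star never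
  lose to each other, so since the dependency digraph has no source and no sink, every edge of one
  star both loses to and beats an edge of the other. This forces \<open>y \<rightarrow> A\<close> and \<open>B \<rightarrow> x\<close>, and
  the forbidden 2-paths make \<open>K = {x, y} \<union> A \<union> B\<close> an interval: every vertex outside \<open>K\<close> dominates all
  of \<open>K\<close> or is dominated by all of \<open>K\<close>. Replacing \<open>D[K]\<close> by a transitive tournament gives a
  tournament \<open>G\<close>. If \<open>G\<close> has no sink, it has two vertices with the second neighborhood property by
  the theorem of Havet and Thomasse. Those outside \<open>K\<close> keep it in \<open>D\<close>. If one lies in \<open>K\<close>, or
  if \<open>G\<close> has a sink (then in \<open>K\<close>), every vertex of \<open>K\<close> has outside \<open>K\<close> at least as many second
  out-neighbours as out-neighbours; then \<open>x\<close>, and any vertex that has the property in the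
  tournament \<open>D[A \<union> B]\<close>, have it in \<open>D\<close>.
\<close>

section \<open>Median orders of tournaments\<close>

locale finite_tournament =
  fixes V :: "'a set" and E :: "('a \<times> 'a) set"
  assumes fin: "finite V"
    and arcs_in: "(u, v) \<in> E \<Longrightarrow> u \<in> V \<and> v \<in> V"
    and asym: "(u, v) \<in> E \<Longrightarrow> (v, u) \<notin> E"
    and total: "\<lbrakk>u \<in> V; v \<in> V; u \<noteq> v\<rbrakk> \<Longrightarrow> (u, v) \<in> E \<or> (v, u) \<in> E"
begin

text \<open>An order of the vertices is given by a rank function, injective on \<open>V\<close> but with gaps allowed,
  so that vertices can be moved without renumbering.\<close>
definition forward :: "('a \<Rightarrow> nat) \<Rightarrow> ('a \<times> 'a) set" where
  "forward r = {(u, v) \<in> E. r u < r v}"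

definition median :: "('a \<Rightarrow> nat) \<Rightarrow> bool" where
  "median r \<longleftrightarrow> inj_on r V \<and> (\<forall>s. inj_on s V \<longrightarrow> card (forward s) \<le> card (forward r))"

definition out_before :: "('a \<Rightarrow> nat) \<Rightarrow> nat \<Rightarrow> 'a \<Rightarrow> 'a set" where
  "out_before r t g = {u. (g, u) \<in> E \<and> t \<le> r u \<and> r u < r g}"

definition in_before :: "('a \<Rightarrow> nat) \<Rightarrow> nat \<Rightarrow> 'a \<Rightarrow> 'a set" where
  "in_before r t g = {u. (u, g) \<in> E \<and> t \<le> r u \<and> r u < r g}"

text \<open>The good vertices of Havet and Thomasse with respect to \<open>g\<close>, for the ranks
  from \<open>t\<close> up to \<open>r g\<close>: second out-neighbours of \<open>g\<close> reached
  through an earlier out-neighbour.\<close>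

definition good :: "('a \<Rightarrow> nat) \<Rightarrow> nat \<Rightarrow> 'a \<Rightarrow> 'a set" where
  "good r t g = {v \<in> in_before r t g. \<exists>u \<in> out_before r t g. r u < r v \<and> (u, v) \<in> E}"

lemma finite_arcs: "finite E"
  by (rule finite_subset[of _ "V \<times> V"]) (use fin arcs_in in auto)

lemma irrefl: "(u, u) \<notin> E"
  using asym by blast

lemma finite_before: "finite (out_before r t g)" "finite (in_before r t g)" "finite (good r t g)"
  by (rule finite_subset[OF _ fin], use arcs_in in \<open>auto simp: out_before_def in_before_def good_def\<close>)+

lemma forward_subset: "forward r \<subseteq> E"
  by (auto simp: forward_def)

lemma finite_forward: "finite (forward r)"
  using forward_subset finite_arcs by (rule finite_subset)

lemma card_forward: 
  "card (forward r) = card (forward r \<inter> forward s) + card (forward r - forward s)"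
  using card_Int_Diff finite_forward by blast

text \<open>Forward arcs common to both orders cancel, so only the arcs turned by a move have to be
  counted.\<close>

lemma medianD:
  assumes "median r" "inj_on s V"
  shows "card (forward s - forward r) \<le> card (forward r - forward s)"
  using assms card_forward[of r s] card_forward[of s r]
  by (auto simp: median_def Int_commute)

lemma medianI:
  assumes "median r" "inj_on s V" "card (forward r - forward s) \<le> card (forward s - forward r)"
  shows "median s"
  using assms card_forward[of r s] card_forward[of s r]
  by (fastforce simp: median_def Int_commute)

lemma median_exists: "\<exists>r. median r"
proof -
  let ?P = "\<lambda>n. \<exists>r. inj_on r V \<and> card (forward r) = n"
  have "\<exists>r :: 'a \<Rightarrow> nat. inj_on r V"
    using fin finite_imp_inj_to_nat_seg by blast
  then have "\<exists>n. ?P n" by blast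
  moreover have "n \<le> card E" if "?P n" for n
    using that card_mono[OF finite_arcs, of "forward _"] forward_subset by auto
  ultimately obtain n where "?P n" "\<And>m. ?P m \<Longrightarrow> m \<le> n"
    using Nat.ex_has_greatest_nat[of ?P] by (metis (no_types, lifting) Nat.nat_le_linear)
  then show ?thesis unfolding median_def by blast
qed

section \<open>The feedback property and good vertices\<close>

text \<open>The rank \<open>r\<close> is compared with the one in which \<open>g\<close> is moved to just below level \<open>t\<close>.\<close>
lemma feedback:
  assumes "median r"
  shows "card (out_before r t g) \<le> card (in_before r t g)"
proof (cases "g \<in> V \<and> t \<le> r g")
  case True
  \<comment> \<open>Doubling makes room: \<open>2 * t\<close> lies below every
    \<open>2 * r v + 1\<close> with \<open>t \<le> r v\<close> and above all others.\<close>
  define s where "s v = (if v = g then 2 * t else 2 * r v + 1)" for v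
  have inj: "inj_on r V" using assms by (simp add: median_def)
  have injs: "inj_on s V"
    using inj by (auto simp: inj_on_def s_def) presburger+
  have "Pair g ` out_before r t g \<subseteq> forward s - forward r"
    using irrefl by (auto simp: forward_def s_def out_before_def)
  then have "card (Pair g ` out_before r t g) \<le> card (forward s - forward r)"
    by (intro card_mono) (simp_all add: finite_forward)
  then have 1: "card (out_before r t g) \<le> card (forward s - forward r)"
    by (simp add: card_image inj_on_def)
  have "forward r - forward s \<subseteq> (\<lambda>u. (u, g)) ` in_before r t g"
  proof clarify
    fix u v assume uv: "(u, v) \<in> forward r" "(u, v) \<notin> forward s"
    then have "(u, v) \<in> E" "r u < r v" "\<not> s u < s v" by (auto simp: forward_def)
    then have "v = g \<and> (u, g) \<in> E \<and> t \<le> r u \<and> r u < r g"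
      using True by (auto simp: s_def split: if_splits)
    then show "(u, v) \<in> (\<lambda>u. (u, g)) ` in_before r t g" by (auto simp: in_before_def)
  qed
  then have "card (forward r - forward s) \<le> card ((\<lambda>u. (u, g)) ` in_before r t g)"
    by (intro card_mono) (simp_all add: finite_before)
  then have 2: "card (forward r - forward s) \<le> card (in_before r t g)"
    by (simp add: card_image inj_on_def)
  show ?thesis using medianD[OF assms injs] 1 2 by simp
next
  case False
  then have "out_before r t g = {}" 
    using arcs_in by (auto simp: out_before_def)
  then show ?thesis by simp
qed

text \<open>Induction on the interval: it is cut at its first bad in-neighbour \<open>b\<close>, which dominates every
  out-neighbour of \<open>g\<close> before it, while all in-neighbours of \<open>g\<close> before \<open>b\<close> are good.\<close>
lemma card_out_before_le_good:
  assumes "median r"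
  shows "card (out_before r t g) \<le> card (good r t g)"
proof (induction "r g - t" arbitrary: t rule: less_induct)
  case less
  let ?bad = "in_before r t g - good r t g"
  show ?case
  proof (cases "?bad = {}")
    case True
    then have "good r t g = in_before r t g" by (auto simp: good_def)
    then show ?thesis using feedback[OF assms] by simp
  next
    case False
    then obtain b where b: "b \<in> ?bad" and b_min: "\<And>v. v \<in> ?bad \<Longrightarrow> r b \<le> r v"
      using ex_has_least_nat[of "\<lambda>v. v \<in> ?bad" _ r] by blast
    have bV: "b \<in> V" "g \<in> V" "(b, g) \<in> E" "t \<le> r b" "r b < r g"
      using b arcs_in by (auto simp: in_before_def)
    have inj: "inj_on r V" using assms by (simp add: median_def)
    have ne: "r u \<noteq> r b" if "u \<in> V" "u \<noteq> b" for u
      using inj that bV by (auto simp: inj_on_def)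
    have ob: "(b, u) \<in> E" if "u \<in> out_before r t g" "r u < r b" for u
    proof -
      have "(u, b) \<notin> E" using that b by (auto simp: good_def)
      moreover have "u \<in> V" using that arcs_in by (auto simp: out_before_def)
      ultimately show ?thesis using total[of u b] bV that by auto
    qed
    \<comment> \<open>\<open>b\<close> is no out-neighbour of \<open>g\<close>, so the upper
      interval can start at \<open>Suc (r b)\<close>, where the induction hypothesis
      applies.\<close>
    have split: "out_before r t g = (out_before r t g \<inter> {u. r u < r b}) \<union> out_before r (Suc (r b)) g"
      using ne bV asym arcs_in by (fastforce simp: out_before_def)
    have "card (out_before r t g \<inter> {u. r u < r b}) \<le> card (out_before r t b)"
      using ob by (intro card_mono finite_before) (auto simp: out_before_def)
    also have "\<dots> \<le> card (in_before r t b)" by (rule feedback[OF assms])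
    \<comment> \<open>An in-neighbour of \<open>b\<close> before \<open>b\<close> is no
      out-neighbour of \<open>g\<close>, as \<open>b\<close> dominates those; so it dominates
      \<open>g\<close>, and by the choice of \<open>b\<close> it is good.\<close>
    also have "\<dots> \<le> card (good r t g \<inter> {u. r u < r b})"
    proof (intro card_mono subsetI)
      fix v assume v: "v \<in> in_before r t b"
      then have vp: "(v, b) \<in> E" "t \<le> r v" "r v < r b" "v \<in> V"
        using arcs_in by (auto simp: in_before_def)
      then have "v \<notin> out_before r t g" using ob asym by blast
      moreover have "v \<noteq> g" using vp bV by auto
      ultimately have "(v, g) \<in> E" using vp bV total[of v g] by (auto simp: out_before_def)
      then have "v \<in> in_before r t g" using vp bV by (auto simp: in_before_def)
      then show "v \<in> good r t g \<inter> {u. r u < r b}" using b_min[of v] vp by auto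
    qed (simp add: finite_before)
    finally have 1: "card (out_before r t g \<inter> {u. r u < r b}) \<le> card (good r t g \<inter> {u. r u < r b})" .
    have "card (out_before r (Suc (r b)) g) \<le> card (good r (Suc (r b)) g)"
      using bV by (intro less.hyps) auto
    also have "\<dots> \<le> card (good r t g \<inter> {u. r b < r u})"
      using bV by (intro card_mono finite_Int disjI1 finite_before)
        (auto simp: good_def in_before_def out_before_def)
    finally have 2: "card (out_before r (Suc (r b)) g) \<le> card (good r t g \<inter> {u. r b < r u})" .
    have "card (out_before r t g) \<le> 
        card (good r t g \<inter> {u. r u < r b}) + card (good r t g \<inter> {u. r b < r u})"
      by (subst split, rule order_trans[OF card_Un_le]) (use 1 2 in linarith)
    also have "\<dots> = card ((good r t g \<inter> {u. r u < r b}) \<union> (good r t g \<inter> {u. r b < r u}))"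
      by (rule card_Un_disjoint[symmetric]) (auto simp: finite_before)
    also have "\<dots> \<le> card (good r t g)"
      by (intro card_mono) (auto simp: finite_before)
    finally show ?thesis .
  qed
qed

text \<open>Subtracting the inequality for the ranks above \<open>b\<close> from the equality for
  all ranks leaves the reverse inequality below \<open>b\<close>. This pays for moving a bad vertex
  \<open>b\<close> to the front.\<close>

lemma card_good_below_le:
  assumes "median r" and eq: "card (out_before r 0 g) = card (good r 0 g)"
    and b: "b \<in> in_before r 0 g" "b \<notin> good r 0 g"
  shows "card (good r 0 g \<inter> {u. r u < r b}) \<le> card (out_before r 0 g \<inter> {u. r u < r b})"
proof -
  have bV: "b \<in> V" "g \<in> V" "(b, g) \<in> E" "r b < r g"
    using b arcs_in by (auto simp: in_before_def)
  have inj: "inj_on r V" using assms by (simp add: median_def)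
  have ne: "r u \<noteq> r b" if "u \<in> V" "u \<noteq> b" for u
    using inj that bV by (auto simp: inj_on_def)
  have gV: "good r 0 g \<subseteq> V" "out_before r 0 g \<subseteq> V"
    using arcs_in by (auto simp: good_def in_before_def out_before_def)
  have "card (out_before r (Suc (r b)) g) \<le> card (good r (Suc (r b)) g)"
    by (rule card_out_before_le_good[OF assms(1)])
  also have "\<dots> \<le> card (good r 0 g - {u. r u < r b})"
    by (intro card_mono finite_Diff finite_before) (auto simp: good_def finite_before in_before_def out_before_def)
  finally have 1: "card (out_before r (Suc (r b)) g) \<le> card (good r 0 g - {u. r u < r b})" .
  have 2: "out_before r (Suc (r b)) g = out_before r 0 g - {u. r u < r b}"
  proof -
    have "Suc (r b) \<le> r u \<longleftrightarrow> \<not> r u < r b" if "u \<in> out_before r 0 g" for u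
    proof -
      have "u \<in> V" "u \<noteq> b" using that gV bV asym by (auto simp: out_before_def)
      then show ?thesis using ne[of u] by auto
    qed
    then show ?thesis by (auto simp: out_before_def)
  qed
  show ?thesis
    using 1 2 eq card_Int_Diff[OF finite_before(1), of r 0 g "{u. r u < r b}"]
      card_Int_Diff[OF finite_before(3), of r 0 g "{u. r u < r b}"]
    by simp
qed

section \<open>Sedimentation of a median order\<close>

text \<open>Sedimentation: the bad in-neighbours of \<open>g\<close>, followed by \<open>g\<close> itself, are moved to the front.\<close>
definition sediment :: "('a \<Rightarrow> nat) \<Rightarrow> 'a \<Rightarrow> 'a \<Rightarrow> nat" where
  "sediment r g v =
     (if v = g \<or> v \<in> in_before r 0 g - good r 0 g then r v else r v + r g + 1)"

text \<open>Forward arcs are lost only between a moved vertex and an earlier out-neighbour or good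
  vertex of \<open>g\<close>. For each moved vertex at least as many are gained: by
  \<open>eq\<close> for \<open>g\<close> itself, by \<open>card_good_below_le\<close> for a bad
  vertex.\<close>

lemma median_sediment:
  assumes "median r" and gV: "g \<in> V" and eq: "card (out_before r 0 g) = card (good r 0 g)"
  shows "median (sediment r g)"
proof (rule medianI[OF assms(1)])
  define B where "B = insert g (in_before r 0 g - good r 0 g)"
  let ?s = "sediment r g"
  let ?W = "out_before r 0 g \<union> good r 0 g"
  have inj: "inj_on r V" using assms by (simp add: median_def)
  have ne: "r u \<noteq> r v" if "u \<in> V" "v \<in> V" "u \<noteq> v" for u v
    using inj that by (auto simp: inj_on_def)
  \<comment> \<open>Hence the shift by \<open>r g + 1\<close> lifts all other vertices above
    \<open>B\<close>, and both groups keep their inner order.\<close>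
  have le: "r v \<le> r g" if "v \<in> B" for v using that by (auto simp: B_def in_before_def)
  have s1: "?s v = r v" if "v \<in> B" for v using that by (auto simp: B_def sediment_def)
  have s2: "?s v = r v + r g + 1" if "v \<notin> B" for v using that by (auto simp: B_def sediment_def)
  show "inj_on ?s V"
  proof (rule inj_onI)
    fix u v assume "u \<in> V" "v \<in> V" "?s u = ?s v"
    then show "u = v" using ne[of u v] s1[of u] s2[of u] s1[of v] s2[of v] le[of u] le[of v]
      by (cases "u \<in> B"; cases "v \<in> B") auto
  qed
  have W: "w \<in> ?W" if "w \<in> V" "r w < r g" "w \<notin> B" for w
    using that total[OF _ gV, of w] by (auto simp: B_def out_before_def in_before_def)
  have B_W: "w \<notin> B" if "w \<in> ?W" for w
    using that asym irrefl by (auto simp: B_def out_before_def in_before_def good_def)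
  \<comment> \<open>\<open>?L\<close> covers the lost arcs, stored reversed, and \<open>?M\<close>
    consists of gained arcs; both are grouped by the end in \<open>B\<close>.\<close>
  let ?L = "SIGMA b:B. {w \<in> ?W. (w, b) \<in> E \<and> r w < r b}"
  let ?M = "SIGMA b:B. {w \<in> ?W. (b, w) \<in> E \<and> r w < r b}"
  have L: "forward r - forward ?s \<subseteq> prod.swap ` ?L"
  proof clarify
    fix u v assume "(u, v) \<in> forward r" "(u, v) \<notin> forward ?s"
    then have *: "(u, v) \<in> E" "r u < r v" "\<not> ?s u < ?s v" "u \<in> V" "v \<in> V"
      using arcs_in by (auto simp: forward_def)
    have v: "v \<in> B"
      using * s1[of u] s2[of u] s2[of v] le[of u] by (cases "u \<in> B"; cases "v \<in> B") simp_all
    moreover have u: "u \<notin> B" using * v s1 by auto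
    moreover have "u \<in> ?W" using * le[OF v] u by (intro W) auto
    ultimately have "(v, u) \<in> ?L" using * by blast
    then show "(u, v) \<in> prod.swap ` ?L" by force
  qed
  have M: "?M \<subseteq> forward ?s - forward r"
  proof clarify
    fix b w assume bw: "b \<in> B" "w \<in> ?W" "(b, w) \<in> E" "r w < r b"
    then have "?s b < ?s w" using s1[of b] s2[OF B_W[of w]] le[of b] by simp
    then show "(b, w) \<in> forward ?s - forward r" using bw by (auto simp: forward_def)
  qed
  have finW: "finite ?W" "finite (B)" by (simp_all add: B_def finite_before)
  have "card (forward r - forward ?s) \<le> card (prod.swap ` ?L)"
    using L finW by (intro card_mono finite_imageI finite_SigmaI) auto
  also have "\<dots> = card ?L" by (intro card_image) auto
  also have "\<dots> = (\<Sum>b\<in>B. card {w \<in> ?W. (w, b) \<in> E \<and> r w < r b})"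
    using finW by (intro card_SigmaI) auto
  also have "\<dots> \<le> (\<Sum>b\<in>B. card {w \<in> ?W. (b, w) \<in> E \<and> r w < r b})"
  proof (rule sum_mono)
    fix b assume b: "b \<in> B"
    show "card {w \<in> ?W. (w, b) \<in> E \<and> r w < r b} \<le> card {w \<in> ?W. (b, w) \<in> E \<and> r w < r b}"
    proof (cases "b = g")
      case True
      have "{w \<in> ?W. (w, b) \<in> E \<and> r w < r b} = good r 0 g"
        "{w \<in> ?W. (b, w) \<in> E \<and> r w < r b} = out_before r 0 g"
        using asym True by (auto simp: out_before_def in_before_def good_def)
      then show ?thesis using eq by simp
    next
      case False
      then have b: "b \<in> in_before r 0 g" "b \<notin> good r 0 g" using b by (auto simp: B_def)
      have bV: "b \<in> V" using b arcs_in by (auto simp: in_before_def)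
      have ob: "(b, u) \<in> E" if "u \<in> out_before r 0 g" "r u < r b" for u
      proof -
        have "(u, b) \<notin> E" using that b by (auto simp: good_def)
        moreover have "u \<in> V" using that arcs_in by (auto simp: out_before_def)
        ultimately show ?thesis using total[of u b] bV that by auto
      qed
      have "card {w \<in> ?W. (w, b) \<in> E \<and> r w < r b} \<le> card (good r 0 g \<inter> {u. r u < r b})"
        using ob asym by (intro card_mono) (auto simp: finite_before)
      also have "\<dots> \<le> card (out_before r 0 g \<inter> {u. r u < r b})"
        by (rule card_good_below_le[OF assms(1) eq b])
      also have "\<dots> \<le> card {w \<in> ?W. (b, w) \<in> E \<and> r w < r b}"
        using ob by (intro card_mono) (auto simp: finite_before)
      finally show ?thesis .
    qed
  qed
  also have "\<dots> = card ?M" using finW by (intro card_SigmaI[symmetric]) auto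
  also have "\<dots> \<le> card (forward ?s - forward r)"
    using M finite_forward by (intro card_mono) auto
  finally show "card (forward r - forward ?s) \<le> card (forward ?s - forward r)" .
qed

section \<open>Two vertices with the second neighborhood property in a tournament\<close>

text \<open>The two vertices are the last vertex \<open>f\<close> and the last but one \<open>g\<close> of a median order in which
  the fewest vertices follow all out-neighbours of \<open>f\<close>: if \<open>g\<close> failed, sedimentation at \<open>g\<close> would
  decrease that number, as it moves \<open>g\<close> before these out-neighbours.\<close>
lemma two_second_nbhd_property:
  assumes ne: "V \<noteq> {}" and nosink: "\<And>v. v \<in> V \<Longrightarrow> \<exists>u. (v, u) \<in> E"
  shows "\<exists>u v. u \<in> V \<and> v \<in> V \<and> u \<noteq> v \<and>
    second_nbhd_property \<lparr>pverts = V, parcs = E\<rparr> u \<and>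
    second_nbhd_property \<lparr>pverts = V, parcs = E\<rparr> v"
proof -
  let ?snp = "second_nbhd_property \<lparr>pverts = V, parcs = E\<rparr>"
  have snp_def: "?snp v \<longleftrightarrow> card {u. (v, u) \<in> E} \<le>
      card {u. (\<exists>w. (v, w) \<in> E \<and> (w, u) \<in> E) \<and> u \<noteq> v \<and> (v, u) \<notin> E}" for v
    by (simp add: second_nbhd_property_def out_nbrs_def second_out_nbrs_def)
  have finV: "finite A" if "A \<subseteq> V" for A using that fin finite_subset by blast
  obtain r0 where r0: "median r0" using median_exists by blast
  obtain f where f: "f \<in> V" "\<And>u. u \<in> V \<Longrightarrow> r0 u \<le> r0 f"
    using obtains_MAX[OF fin ne, of r0] fin by (metis Max_ge finite_imageI imageI)
  let ?P = "\<lambda>r. median r \<and> (\<forall>u\<in>V - {f}. r u < r f)"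
  let ?m = "\<lambda>r. card {u \<in> V. \<forall>w. (f, w) \<in> E \<longrightarrow> r w < r u}"
  have "?P r0" using r0 f by (force simp: median_def inj_on_def le_less)
  then obtain r where P: "?P r" and min: "\<And>s. ?P s \<Longrightarrow> ?m r \<le> ?m s"
    using ex_has_least_nat[of ?P r0 ?m] by blast
  have med: "median r" and top: "\<And>u. u \<in> V \<Longrightarrow> u \<noteq> f \<Longrightarrow> r u < r f" using P by blast+
  obtain h where h: "(f, h) \<in> E" using nosink f by blast
  then have hV: "h \<in> V - {f}" using arcs_in irrefl by blast
  obtain g where g: "g \<in> V - {f}" "\<And>u. u \<in> V - {f} \<Longrightarrow> r u \<le> r g"
    using obtains_MAX[of "V - {f}" r] hV fin by (metis Max_ge finite_Diff finite_imageI imageI empty_iff)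
  have inj: "inj_on r V" using med by (simp add: median_def)
  have gtop: "r u < r g" if "u \<in> V" "u \<noteq> f" "u \<noteq> g" for u
    using g that inj by (metis DiffE DiffI inj_onD le_neq_implies_less singletonD)
  have gf: "(g, f) \<in> E"
  proof (rule ccontr)
    assume "(g, f) \<notin> E"
    then have fg: "(f, g) \<in> E" using total g f by blast
    \<comment> \<open>From rank \<open>r g\<close> on, only \<open>g\<close> comes before
      \<open>f\<close>, so the feedback property fails there if
      \<open>f \<rightarrow> g\<close>.\<close>
    have "out_before r (r g) f = {g}" using fg top gtop g arcs_in irrefl
      by (force simp: out_before_def)
    moreover have "in_before r (r g) f = {}" using fg gtop asym arcs_in irrefl
      by (force simp: in_before_def)
    ultimately show False using feedback[OF med, of "r g" f] by simp
  qed
  have "?snp f"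
  proof -
    have "{u. (f, u) \<in> E} = out_before r 0 f" using top arcs_in irrefl by (force simp: out_before_def)
    then have "card {u. (f, u) \<in> E} \<le> card (good r 0 f)" using card_out_before_le_good[OF med] by simp
    also have "\<dots> \<le> card {u. (\<exists>w. (f, w) \<in> E \<and> (w, u) \<in> E) \<and> u \<noteq> f \<and> (f, u) \<notin> E}"
      using arcs_in irrefl asym
      by (intro card_mono finV) (auto simp: good_def in_before_def out_before_def)
    finally show ?thesis by (simp add: snp_def)
  qed
  moreover have "?snp g"
  proof (rule ccontr)
    assume not: "\<not> ?snp g"
    let ?S = "{u. (\<exists>w. (g, w) \<in> E \<and> (w, u) \<in> E) \<and> u \<noteq> g \<and> (g, u) \<notin> E}"
    \<comment> \<open>\<open>f\<close> is the only out-neighbour of \<open>g\<close> above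
      \<open>g\<close>. Failure at \<open>g\<close> therefore forces equality in the estimates, and
      every second out-neighbour of \<open>g\<close> is good.\<close>
    have Nout: "{u. (g, u) \<in> E} = insert f (out_before r 0 g)"
      using gf gtop arcs_in irrefl by (force simp: out_before_def)
    have "card {u. (g, u) \<in> E} \<le> Suc (card (out_before r 0 g))"
      unfolding Nout by (simp add: card_insert_if finite_before)
    then have lt: "card ?S \<le> card (out_before r 0 g)" using not by (simp add: snp_def)
    have GS: "good r 0 g \<subseteq> ?S" using asym irrefl by (auto simp: good_def in_before_def out_before_def)
    have finS: "finite ?S" using arcs_in by (intro finV) auto
    have "card (good r 0 g) \<le> card ?S" by (rule card_mono[OF finS GS])
    then have eq: "card (out_before r 0 g) = card (good r 0 g)" and "card ?S \<le> card (good r 0 g)"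
      using lt card_out_before_le_good[OF med, of 0 g] by auto
    then have SG: "?S = good r 0 g" using card_seteq[OF finS GS] by auto
    \<comment> \<open>As \<open>g \<rightarrow> f\<close>, an out-neighbour of \<open>f\<close> is a
      first or second out-neighbour of \<open>g\<close>, hence ranked below \<open>g\<close> and not
      among the moved vertices.\<close>
    have fw: "w \<in> out_before r 0 g \<union> good r 0 g" if "(f, w) \<in> E" for w
    proof (cases "(g, w) \<in> E")
      case True
      then have "w \<in> insert f (out_before r 0 g)" unfolding Nout[symmetric] by simp
      then show ?thesis using that irrefl by auto
    next
      case False
      then have "w \<in> ?S" using that gf asym by auto
      then show ?thesis unfolding SG by (rule UnI2)
    qed
    have fw': "w \<noteq> g \<and> w \<notin> in_before r 0 g - good r 0 g" if "(f, w) \<in> E" for w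
      using fw[OF that] asym irrefl by (auto simp: out_before_def in_before_def good_def)
    let ?s = "sediment r g"
    have med_s: "median ?s" using median_sediment[OF med _ eq] g by auto
    have "f \<noteq> g" "f \<notin> in_before r 0 g" using g gf asym by (auto simp: in_before_def)
    then have "?s f = r f + r g + 1" by (simp add: sediment_def)
    moreover have "?s u \<le> r u + r g + 1" for u by (simp add: sediment_def)
    ultimately have "\<forall>u\<in>V - {f}. ?s u < ?s f" using top by (metis DiffE add_less_mono1 insertCI le_less_trans)
    with med_s have "?m r \<le> ?m ?s" by (intro min) simp
    \<comment> \<open>Before the move \<open>g\<close> follows all out-neighbours of
      \<open>f\<close>, afterwards it precedes \<open>h\<close>; and no vertex newly joins the
      set.\<close>
    moreover have "?m ?s < ?m r"
    proof (rule psubset_card_mono)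
      show "finite {u \<in> V. \<forall>w. (f, w) \<in> E \<longrightarrow> r w < r u}" by (simp add: fin)
      have "r w < r u" if "(f, w) \<in> E" "?s w < ?s u" for u w
        using fw'[OF that(1)] that(2) by (auto simp: sediment_def in_before_def split: if_splits)
      then have "{u \<in> V. \<forall>w. (f, w) \<in> E \<longrightarrow> ?s w < ?s u} \<subseteq> {u \<in> V. \<forall>w. (f, w) \<in> E \<longrightarrow> r w < r u}"
        by blast
      moreover have "\<not> ?s h < ?s g" using fw'[OF h] by (auto simp: sediment_def)
      moreover have "r w < r g" if "(f, w) \<in> E" for w
        using fw[OF that] by (auto simp: out_before_def in_before_def good_def)
      ultimately show "{u \<in> V. \<forall>w. (f, w) \<in> E \<longrightarrow> ?s w < ?s u} \<subset> {u \<in> V. \<forall>w. (f, w) \<in> E \<longrightarrow> r w < r u}"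
        using h g by blast
    qed
    ultimately show False by simp
  qed
  ultimately show ?thesis using f g by blast
qed

lemma exists_second_nbhd_property:
  assumes "V \<noteq> {}"
  shows "\<exists>v\<in>V. second_nbhd_property \<lparr>pverts = V, parcs = E\<rparr> v"
proof (cases "\<exists>v\<in>V. \<forall>u. (v, u) \<notin> E")
  case True
  then obtain v where "v \<in> V" "{u. (v, u) \<in> E} = {}" by blast
  then show ?thesis by (intro bexI[of _ v]) (simp_all add: second_nbhd_property_def out_nbrs_def)
next
  case False
  then show ?thesis using two_second_nbhd_property[OF assms] by blast
qed

end

section \<open>Two stars without sources and sinks in the dependency digraph\<close>

text \<open>The tournament survives only in \<open>missing\<close>; the direction \<open>xy\<close>
  breaks the symmetry between the two stars.\<close>

locale dependent_stars =
  fixes D :: "'a pair_pre_digraph" and x y :: 'a and A B :: "'a set" and E V M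
  defines "E \<equiv> parcs D" and "V \<equiv> pverts D"
    and "M \<equiv> (\<lambda>a. {a, x}) ` A \<union> (\<lambda>b. {b, y}) ` B"
  assumes fin: "finite V"
    and arcs_in: "(u, v) \<in> E \<Longrightarrow> u \<in> V \<and> v \<in> V"
    and asym: "(u, v) \<in> E \<Longrightarrow> (v, u) \<notin> E"
    and missing: "\<lbrakk>u \<in> V; v \<in> V; u \<noteq> v\<rbrakk> \<Longrightarrow> (u, v) \<notin> E \<and> (v, u) \<notin> E \<longleftrightarrow> {u, v} \<in> M"
    and verts: "x \<in> V" "y \<in> V" "A \<subseteq> V" "B \<subseteq> V"
    and nonempty: "A \<noteq> {}" "B \<noteq> {}"
    and disjoint: "x \<notin> A" "x \<notin> B" "y \<notin> A" "y \<notin> B" "A \<inter> B = {}" "x \<noteq> y"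
    and xy: "(x, y) \<in> E"
    and no_source: "\<not> (\<exists>e. is_source (dependency_digraph D) e)"
    and no_sink: "\<not> (\<exists>e. is_sink (dependency_digraph D) e)"
begin

definition K :: "'a set" where "K = {x, y} \<union> A \<union> B"

definition two_path :: "'a \<Rightarrow> 'a \<Rightarrow> bool" where
  "two_path u v \<longleftrightarrow> (\<exists>w. (u, w) \<in> E \<and> (w, v) \<in> E)"

lemma irrefl: "(u, u) \<notin> E"
  using asym by blast

lemma finite_nbrs: "finite (out_nbrs D u)" "finite (second_out_nbrs D u)"
  by (rule finite_subset[OF _ fin], use arcs_in in \<open>auto simp: out_nbrs_def second_out_nbrs_def E_def\<close>)+

lemma missing_sub_K: "{u, v} \<in> M \<Longrightarrow> u \<in> K \<and> v \<in> K"
  by (auto simp: M_def K_def doubleton_eq_iff)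

lemma K_sub: "K \<subseteq> V"
  using verts by (auto simp: K_def)

lemma missing_A: "a \<in> A \<Longrightarrow> (a, x) \<notin> E \<and> (x, a) \<notin> E"
  and missing_B: "b \<in> B \<Longrightarrow> (b, y) \<notin> E \<and> (y, b) \<notin> E"
  using missing[of a x] missing[of b y] verts disjoint by (auto simp: M_def)

lemma adj:
  assumes "u \<in> V" "v \<in> V" "u \<noteq> v" "{u, v} \<notin> M"
  shows "(u, v) \<in> E \<or> (v, u) \<in> E"
  using missing assms by blast

lemma missing_edges_eq: "missing_edges D = M"
proof
  show "missing_edges D \<subseteq> M"
    using missing by (auto simp: missing_edges_def E_def V_def)
  show "M \<subseteq> missing_edges D"
    using verts disjoint missing_A missing_B
    by (fastforce simp: missing_edges_def M_def E_def V_def)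
qed

lemma adj_yA: "a \<in> A \<Longrightarrow> (a, y) \<in> E \<or> (y, a) \<in> E"
  using disjoint verts by (intro adj) (auto simp: M_def doubleton_eq_iff)

lemma adj_xB: "b \<in> B \<Longrightarrow> (b, x) \<in> E \<or> (x, b) \<in> E"
  using disjoint verts by (intro adj) (auto simp: M_def doubleton_eq_iff)

lemma adj_W: "\<lbrakk>u \<in> A \<union> B; v \<in> A \<union> B; u \<noteq> v\<rbrakk> \<Longrightarrow> (u, v) \<in> E \<or> (v, u) \<in> E"
  using disjoint verts by (intro adj) (auto simp: M_def doubleton_eq_iff)

text \<open>The guards stem from \<open>second_out_nbrs\<close>, which excludes the vertex itself
  while \<open>two_path\<close> does not. They hold once the two edges are known to lie in different
  stars.\<close>

lemma loses_to_arcs: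
  assumes "loses_to D e e'"
  obtains x1 y1 x2 y2 where "e = {x1, y1}" "e' = {x2, y2}" "(x1, x2) \<in> E" "(x1, y2) \<notin> E"
    "y2 \<noteq> x1 \<longrightarrow> \<not> two_path x1 y2" "(y1, y2) \<in> E" "(y1, x2) \<notin> E" "x2 \<noteq> y1 \<longrightarrow> \<not> two_path y1 x2"
proof -
  from assms obtain x1 y1 x2 y2 where "e = {x1, y1}" "e' = {x2, y2}" "(x1, x2) \<in> E" "(y1, y2) \<in> E"
    and n: "y2 \<notin> out_nbrs D x1 \<union> second_out_nbrs D x1" "x2 \<notin> out_nbrs D y1 \<union> second_out_nbrs D y1"
    unfolding loses_to_def E_def[symmetric] by blast
  with that[OF this(1-3) _ _ this(4)] show ?thesis
    by (auto simp: out_nbrs_def second_out_nbrs_def two_path_def E_def[symmetric])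
qed

text \<open>An arc from \<open>x\<close> to an end of an edge at \<open>x\<close> would be a loop or
  a missing edge, so \<open>e'\<close> lies in the other star. As \<open>x \<rightarrow> y\<close>,
  the losing arcs can only be \<open>x \<rightarrow> y\<close> and \<open>a \<rightarrow> b\<close>;
  adjacency turns the non-arcs around.\<close>

lemma loses_A:
  assumes a: "a \<in> A" and e': "e' \<in> M" and l: "loses_to D {a, x} e'"
  shows "\<exists>b\<in>B. e' = {b, y} \<and> (a, b) \<in> E \<and> (y, a) \<in> E \<and> (b, x) \<in> E \<and>
    \<not> two_path x b \<and> \<not> two_path a y"
proof -
  from l obtain x1 y1 x2 y2 where e: "{a, x} = {x1, y1}" "e' = {x2, y2}"
    and l: "(x1, x2) \<in> E" "(x1, y2) \<notin> E" "y2 \<noteq> x1 \<longrightarrow> \<not> two_path x1 y2"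
      "(y1, y2) \<in> E" "(y1, x2) \<notin> E" "x2 \<noteq> y1 \<longrightarrow> \<not> two_path y1 x2"
    by (rule loses_to_arcs) blast
  have no: "e' \<noteq> {a', x}" if "a' \<in> A" for a'
    using e l missing_A[OF a] missing_A[OF that] irrefl
    by (auto simp: doubleton_eq_iff)
  then obtain b where b: "b \<in> B" "e' = {b, y}" using e' by (auto simp: M_def)
  then have ne: "b \<noteq> x" "a \<noteq> y" "b \<noteq> a" "x \<noteq> y" using a disjoint by auto
  show ?thesis
    using b e l ne xy adj_yA[OF a] adj_xB[OF b(1)]
    by (intro bexI[of _ b]) (auto simp: doubleton_eq_iff)
qed

text \<open>As in \<open>loses_A\<close>, but now \<open>y \<rightarrow> x\<close> is impossible, so
  the losing arcs are crossed: \<open>y \<rightarrow> a\<close> and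
  \<open>b \<rightarrow> x\<close>.\<close>

lemma loses_B:
  assumes b: "b \<in> B" and e': "e' \<in> M" and l: "loses_to D {b, y} e'"
  shows "\<exists>a\<in>A. e' = {a, x} \<and> (a, b) \<in> E \<and> (y, a) \<in> E \<and> (b, x) \<in> E \<and>
    \<not> two_path y x \<and> \<not> two_path b a"
proof -
  from l obtain x1 y1 x2 y2 where e: "{b, y} = {x1, y1}" "e' = {x2, y2}"
    and l: "(x1, x2) \<in> E" "(x1, y2) \<notin> E" "y2 \<noteq> x1 \<longrightarrow> \<not> two_path x1 y2"
      "(y1, y2) \<in> E" "(y1, x2) \<notin> E" "x2 \<noteq> y1 \<longrightarrow> \<not> two_path y1 x2"
    by (rule loses_to_arcs) blast
  have no: "e' \<noteq> {b', y}" if "b' \<in> B" for b'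
    using e l missing_B[OF b] missing_B[OF that] irrefl
    by (auto simp: doubleton_eq_iff)
  then obtain a where a: "a \<in> A" "e' = {a, x}" using e' by (auto simp: M_def)
  then have ne: "b \<noteq> x" "a \<noteq> y" "b \<noteq> a" "x \<noteq> y" using b disjoint by auto
  have yx: "(y, x) \<notin> E" using xy asym by blast
  have "(a, b) \<in> E \<or> (b, a) \<in> E" using adj_W a b ne by blast
  then show ?thesis
    using a e l ne yx
    by (intro bexI[of _ a]) (auto simp: doubleton_eq_iff)
qed

section \<open>Consequences of the lack of sources and sinks\<close>

lemma out_dep:
  assumes "e \<in> M"
  shows "\<exists>e'\<in>M. loses_to D e e'"
proof (rule ccontr)
  assume "\<not> ?thesis"
  then have none: "out_arcs (with_proj (dependency_digraph D)) e = {}"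
    by (auto simp: dependency_digraph_def missing_edges_eq out_arcs_def)
  have "is_sink (dependency_digraph D) e"
    unfolding is_sink_def out_degree_def none
    using assms by (simp add: dependency_digraph_def missing_edges_eq)
  then show False using no_sink by blast
qed

lemma in_dep:
  assumes "e \<in> M"
  shows "\<exists>e'\<in>M. loses_to D e' e"
proof (rule ccontr)
  assume "\<not> ?thesis"
  then have none: "in_arcs (with_proj (dependency_digraph D)) e = {}"
    by (auto simp: dependency_digraph_def missing_edges_eq in_arcs_def)
  have "is_source (dependency_digraph D) e"
    unfolding is_source_def in_degree_def none
    using assms by (simp add: dependency_digraph_def missing_edges_eq)
  then show False using no_source by blast
qed

text \<open>With the next three lemmas this closes a chain of absent 2-paths: \<open>A\<close> to
  \<open>y\<close> to \<open>x\<close> to \<open>B\<close> and, between suitable leaves, back to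
  \<open>A\<close>. Facts about a given start leaf use \<open>no_sink\<close>, those about a given
  target leaf \<open>no_source\<close>.\<close>

lemma A_out:
  assumes "a \<in> A"
  shows "(y, a) \<in> E" "\<not> two_path a y"
proof -
  have "{a, x} \<in> M" using assms by (simp add: M_def)
  then obtain e' where "e' \<in> M" "loses_to D {a, x} e'" using out_dep by blast
  from loses_A[OF assms this] show "(y, a) \<in> E" "\<not> two_path a y" by blast+
qed

lemma B_out:
  assumes "b \<in> B"
  shows "(b, x) \<in> E" "\<not> two_path y x" "\<exists>a\<in>A. \<not> two_path b a"
proof -
  have "{b, y} \<in> M" using assms by (simp add: M_def)
  then obtain e' where "e' \<in> M" "loses_to D {b, y} e'" using out_dep by blast
  from loses_B[OF assms this]
  show "(b, x) \<in> E" "\<not> two_path y x" "\<exists>a\<in>A. \<not> two_path b a" by blast+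
qed

lemma A_in:
  assumes "a \<in> A"
  shows "\<exists>b\<in>B. \<not> two_path b a"
proof -
  obtain e' where e': "e' \<in> M" "loses_to D e' {a, x}" using in_dep[of "{a, x}"] assms by (auto simp: M_def)
  show ?thesis
  proof (cases "e' \<in> (\<lambda>b. {b, y}) ` B")
    case True
    then obtain b where b: "b \<in> B" "e' = {b, y}" by blast
    then obtain a' where "a' \<in> A" "{a, x} = {a', x}" "\<not> two_path b a'"
      using loses_B[of b "{a, x}"] e' assms by (auto simp: M_def)
    then show ?thesis using b by (auto simp: doubleton_eq_iff)
  next
    case False
    then obtain a' where "a' \<in> A" "e' = {a', x}" using e' by (auto simp: M_def)
    then show ?thesis using loses_A[of a' "{a, x}"] e' assms disjoint by (auto simp: M_def doubleton_eq_iff)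
  qed
qed

lemma B_in:
  assumes "b \<in> B"
  shows "\<not> two_path x b"
proof -
  obtain e' where e': "e' \<in> M" "loses_to D e' {b, y}" using in_dep[of "{b, y}"] assms by (auto simp: M_def)
  show ?thesis
  proof (cases "e' \<in> (\<lambda>a. {a, x}) ` A")
    case True
    then obtain a where a: "a \<in> A" "e' = {a, x}" by blast
    then obtain b' where "b' \<in> B" "{b, y} = {b', y}" "\<not> two_path x b'"
      using loses_A[of a "{b, y}"] e' assms by (auto simp: M_def)
    then show ?thesis by (auto simp: doubleton_eq_iff)
  next
    case False
    then obtain b' where "b' \<in> B" "e' = {b', y}" using e' by (auto simp: M_def)
    then show ?thesis using loses_B[of b' "{b, y}"] e' assms disjoint by (auto simp: M_def doubleton_eq_iff)
  qed
qed

section \<open>\<open>K\<close> as an interval, and counting inside it\<close>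

lemma adj_outside:
  assumes "v \<in> V" "v \<notin> K" "u \<in> V" "u \<noteq> v"
  shows "(u, v) \<in> E \<longleftrightarrow> (v, u) \<notin> E"
  using assms adj[of u v] asym missing_sub_K by blast

text \<open>The absence of 2-paths propagates \<open>(k, v) \<in> E\<close> along \<open>A\<close>, \<open>y\<close>, \<open>x\<close>, \<open>B\<close> and back to \<open>A\<close>.\<close>
lemma interval_out:
  assumes "v \<in> V" "v \<notin> K" "k \<in> K"
  shows "(k, v) \<in> E \<longleftrightarrow> (x, v) \<in> E"
proof -
  have adjK: "(u, v) \<in> E \<or> (v, u) \<in> E" if "u \<in> K" for u
    using adj_outside[OF assms(1,2), of u] that K_sub assms(2) by blast
  \<comment> \<open>Otherwise \<open>v \<rightarrow> w\<close>, and \<open>u\<close>,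
    \<open>v\<close>, \<open>w\<close> is the forbidden 2-path.\<close>
  have step: "(w, v) \<in> E" if "\<not> two_path u w" "(u, v) \<in> E" "w \<in> K" for u w
    using that adjK[of w] by (auto simp: two_path_def)
  have inK: "x \<in> K" "y \<in> K" "\<And>a. a \<in> A \<Longrightarrow> a \<in> K" "\<And>b. b \<in> B \<Longrightarrow> b \<in> K" by (auto simp: K_def)
  have xb: "(b, v) \<in> E" if "b \<in> B" "(x, v) \<in> E" for b
    using step[OF B_in[OF that(1)] that(2)] that inK by blast
  have xa: "(a, v) \<in> E" if "a \<in> A" "(x, v) \<in> E" for a
    using A_in[OF that(1)] xb that step inK by blast
  have yx: "(x, v) \<in> E" if "(y, v) \<in> E"
    using B_out(2) nonempty that step inK by blast
  have ay: "(y, v) \<in> E" if "a \<in> A" "(a, v) \<in> E" for a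
    using step[OF A_out(2)[OF that(1)] that(2)] inK by blast
  have ba: "(x, v) \<in> E" if "b \<in> B" "(b, v) \<in> E" for b
    using B_out(3)[OF that(1)] that step inK ay yx by blast
  obtain a where "a \<in> A" using nonempty by blast
  then have xy': "(y, v) \<in> E" if "(x, v) \<in> E" using xa ay that by blast
  show ?thesis using assms(3) xa xb yx ay ba xy' by (auto simp: K_def)
qed

lemma interval_in:
  assumes "v \<in> V" "v \<notin> K" "k \<in> K"
  shows "(v, k) \<in> E \<longleftrightarrow> (v, x) \<in> E"
proof -
  have "k \<in> V" "k \<noteq> v" "x \<in> V" "x \<noteq> v" using assms K_sub verts K_def by auto
  then show ?thesis
    using interval_out[OF assms] adj_outside[OF assms(1,2)] by blast
qed

text \<open>All vertices of \<open>K\<close> have the same out-neighbours outside \<open>K\<close>,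
  and at least the second out-neighbours that \<open>x\<close> has there; \<open>ext\<close> thus
  reduces the property to counts inside \<open>K\<close>.\<close>

lemma two_second_nbhd_property_in_K:
  assumes ext: "card (out_nbrs D x - K) \<le> card (second_out_nbrs D x - K)"
  shows "\<exists>u v. u \<in> V \<and> v \<in> V \<and> u \<noteq> v \<and> second_nbhd_property D u \<and> second_nbhd_property D v"
proof -
  have snpI: "second_nbhd_property D k"
    if k: "k \<in> K" and le: "card (out_nbrs D k \<inter> K) \<le> card (second_out_nbrs D k \<inter> K)" for k
  proof -
    have "out_nbrs D k - K = out_nbrs D x - K"
      using interval_out[OF _ _ k] arcs_in unfolding out_nbrs_def E_def[symmetric] by blast
    moreover have "second_out_nbrs D x - K \<subseteq> second_out_nbrs D k - K"
    proof
      fix u assume "u \<in> second_out_nbrs D x - K"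
      then obtain w where w: "(x, w) \<in> E" "(w, u) \<in> E" "(x, u) \<notin> E" "u \<notin> K"
        by (auto simp: second_out_nbrs_def E_def[symmetric])
      then have uw: "u \<in> V" "w \<in> V" using arcs_in by auto
      then have "w \<notin> K" using interval_out[of u w] w by blast
      then have "(k, w) \<in> E" "(k, u) \<notin> E" "u \<noteq> k"
        using interval_out[OF _ _ k] w uw k by blast+
      then show "u \<in> second_out_nbrs D k - K" using w by (auto simp: second_out_nbrs_def E_def[symmetric])
    qed
    then have "card (second_out_nbrs D x - K) \<le> card (second_out_nbrs D k - K)"
      using finite_nbrs by (intro card_mono) auto
    ultimately show ?thesis
      unfolding second_nbhd_property_def
      using ext le card_Int_Diff[OF finite_nbrs(1), of k K] card_Int_Diff[OF finite_nbrs(2), of k K] by simp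
  qed
  \<comment> \<open>Inside \<open>K\<close>, \<open>x\<close> dominates only \<open>y\<close>, and
    \<open>y\<close> dominates the nonempty \<open>A\<close>.\<close>
  have x: "second_nbhd_property D x"
  proof (rule snpI)
    have "(x, b) \<notin> E" if "b \<in> B" for b using B_out(1)[OF that] asym by blast
    then have "out_nbrs D x \<inter> K \<subseteq> {y}"
      using missing_A irrefl by (auto simp: K_def out_nbrs_def E_def[symmetric])
    then have "card (out_nbrs D x \<inter> K) \<le> 1" using card_mono[of "{y}"] by simp
    also have "1 \<le> card A"
      using nonempty finite_subset[OF verts(3) fin] by (simp add: Suc_le_eq card_gt_0_iff)
    also have "A \<subseteq> second_out_nbrs D x \<inter> K"
      using missing_A A_out(1) xy disjoint by (auto simp: K_def second_out_nbrs_def E_def[symmetric])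
    then have "card A \<le> card (second_out_nbrs D x \<inter> K)" using finite_nbrs by (intro card_mono) auto
    finally show "card (out_nbrs D x \<inter> K) \<le> card (second_out_nbrs D x \<inter> K)" .
  qed (simp add: K_def)
  \<comment> \<open>Every missing edge contains a center, so without the centers \<open>K\<close>
    induces a tournament.\<close>
  let ?W = "A \<union> B"
  let ?H = "\<lparr>pverts = ?W, parcs = E \<inter> ?W \<times> ?W\<rparr>"
  interpret W: finite_tournament ?W "E \<inter> ?W \<times> ?W"
  proof
    show "finite ?W" using finite_subset[OF _ fin] verts by blast
  qed (use adj_W asym in auto)
  obtain v where v: "v \<in> ?W" "second_nbhd_property ?H v"
    using W.exists_second_nbhd_property nonempty by blast
  have vle: "card (out_nbrs ?H v) \<le> card (second_out_nbrs ?H v)"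
    using v by (simp add: second_nbhd_property_def)
  have sub2: "second_out_nbrs ?H v \<subseteq> second_out_nbrs D v \<inter> K"
    using v by (auto simp: second_out_nbrs_def E_def K_def)
  have finH: "finite (out_nbrs ?H v)"
    by (rule finite_subset[OF _ W.fin]) (auto simp: out_nbrs_def)
  have "second_nbhd_property D v"
  proof (rule snpI)
    show "v \<in> K" using v by (auto simp: K_def)
    show "card (out_nbrs D v \<inter> K) \<le> card (second_out_nbrs D v \<inter> K)"
    proof (cases "v \<in> A")
      case True
      \<comment> \<open>A leaf in \<open>A\<close> dominates neither center, so \<open>K\<close>
        adds no out-neighbour.\<close>
      have "(v, y) \<notin> E" using A_out(1)[OF True] asym by blast
      then have "out_nbrs D v \<inter> K \<subseteq> out_nbrs ?H v"
        using missing_A[OF True] v by (auto simp: K_def out_nbrs_def E_def[symmetric])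
      then have "card (out_nbrs D v \<inter> K) \<le> card (out_nbrs ?H v)" using finH by (intro card_mono) auto
      also note vle
      also have "card (second_out_nbrs ?H v) \<le> card (second_out_nbrs D v \<inter> K)"
        using sub2 finite_nbrs by (intro card_mono) auto
      finally show ?thesis .
    next
      case False
      then have B: "v \<in> B" using v by auto
      \<comment> \<open>A leaf in \<open>B\<close> also dominates \<open>x\<close>; this is offset
        by \<open>y\<close>, as \<open>v \<rightarrow> x \<rightarrow> y\<close> and
        \<open>{v, y}\<close> is missing.\<close>
      have "out_nbrs D v \<inter> K \<subseteq> insert x (out_nbrs ?H v)"
        using missing_B[OF B] v by (auto simp: K_def out_nbrs_def E_def[symmetric])
      then have "card (out_nbrs D v \<inter> K) \<le> card (insert x (out_nbrs ?H v))"
        using finH by (intro card_mono) auto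
      also have "\<dots> \<le> Suc (card (out_nbrs ?H v))" by (simp add: card_insert_if finH)
      also have "\<dots> \<le> Suc (card (second_out_nbrs ?H v))" using vle by simp
      also have "\<dots> = card (insert y (second_out_nbrs ?H v))"
        using disjoint finite_subset[OF sub2] finite_nbrs by (subst card_insert_disjoint) (auto simp: second_out_nbrs_def)
      also have "\<dots> \<le> card (second_out_nbrs D v \<inter> K)"
      proof (intro card_mono)
        have "y \<in> second_out_nbrs D v \<inter> K"
          using B_out(1)[OF B] xy missing_B[OF B] B disjoint
          by (auto simp: K_def second_out_nbrs_def E_def[symmetric])
        then show "insert y (second_out_nbrs ?H v) \<subseteq> second_out_nbrs D v \<inter> K" using sub2 by auto
      qed (use finite_nbrs in auto)
      finally show ?thesis .
    qed
  qed
  moreover have "v \<in> V" "v \<noteq> x" using v verts disjoint by auto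
  ultimately show ?thesis using x verts by blast
qed

section \<open>Passage to a tournament by replacing the arcs inside \<open>K\<close>\<close>

lemma two_second_nbhd_property:
  assumes nosink: "\<not> (\<exists>v. is_sink D v)"
  shows "\<exists>u v. u \<in> V \<and> v \<in> V \<and> u \<noteq> v \<and> second_nbhd_property D u \<and> second_nbhd_property D v"
proof -
  obtain \<rho> :: "'a \<Rightarrow> nat" where \<rho>: "inj_on \<rho> V" using finite_imp_inj_to_nat_seg[OF fin] by blast
  define F where "F = {(u, v) \<in> E. u \<notin> K \<or> v \<notin> K} \<union> {(u, v). u \<in> K \<and> v \<in> K \<and> \<rho> u < \<rho> v}"
  let ?G = "\<lparr>pverts = V, parcs = F\<rparr>"
  have F_E: "(u, v) \<in> F \<longleftrightarrow> (u, v) \<in> E" if "u \<notin> K \<or> v \<notin> K" for u v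
    using that by (auto simp: F_def)
  have F_K: "(u, v) \<in> F \<longleftrightarrow> \<rho> u < \<rho> v" if "u \<in> K" "v \<in> K" for u v
    using that by (auto simp: F_def)
  interpret G: finite_tournament V F
  proof
    fix u v assume uv: "u \<in> V" "v \<in> V" "u \<noteq> v"
    show "(u, v) \<in> F \<or> (v, u) \<in> F"
    proof (cases "u \<in> K \<and> v \<in> K")
      case True
      moreover have "\<rho> u \<noteq> \<rho> v" using inj_onD[OF \<rho>] uv by blast
      ultimately show ?thesis by (simp add: F_K linorder_neq_iff)
    next
      case False
      moreover from this have "(u, v) \<in> E \<or> (v, u) \<in> E"
        using adj[OF uv] missing_sub_K by blast
      ultimately show ?thesis using F_E[of u v] F_E[of v u] by blast
    qed
  qed (use fin arcs_in asym K_sub in \<open>auto simp: F_def\<close>)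
  have outside: "second_nbhd_property D v" if v: "v \<in> V" "v \<notin> K" "second_nbhd_property ?G v" for v
  proof -
    have "out_nbrs D v = out_nbrs ?G v" using F_E v(2) by (simp add: out_nbrs_def E_def[symmetric])
    moreover have "second_out_nbrs ?G v \<subseteq> second_out_nbrs D v"
    proof
      fix u assume "u \<in> second_out_nbrs ?G v"
      then obtain w where w: "(v, w) \<in> E" "(w, u) \<in> F" "u \<noteq> v" "(v, u) \<notin> E"
        using F_E v by (auto simp: second_out_nbrs_def)
      \<comment> \<open>A replaced arc inside \<open>K\<close> creates no second out-neighbour of
        \<open>v\<close>, since \<open>v\<close> dominates all of \<open>K\<close> or none of
        it.\<close>
      then have "\<not> (w \<in> K \<and> u \<in> K)" using interval_in[OF v(1,2)] by blast
      then show "u \<in> second_out_nbrs D v" using w F_E by (auto simp: second_out_nbrs_def E_def[symmetric])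
    qed
    then have "card (second_out_nbrs ?G v) \<le> card (second_out_nbrs D v)"
      by (intro card_mono finite_nbrs)
    ultimately show ?thesis using v(3) unfolding second_nbhd_property_def by simp
  qed
  have inside: ?thesis if v: "v \<in> K" "second_nbhd_property ?G v" for v
  proof (rule two_second_nbhd_property_in_K)
    have fin2: "finite (out_nbrs ?G v)"
      by (rule finite_subset[OF _ fin]) (use G.arcs_in in \<open>auto simp: out_nbrs_def\<close>)
    have "out_nbrs D x - K \<subseteq> out_nbrs ?G v"
      using interval_out[OF _ _ v(1)] arcs_in F_E by (simp add: out_nbrs_def E_def[symmetric]) blast
    then have "card (out_nbrs D x - K) \<le> card (out_nbrs ?G v)" using fin2 by (intro card_mono)
    also have "\<dots> \<le> card (second_out_nbrs ?G v)" using v(2) by (simp add: second_nbhd_property_def)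
    also have "\<dots> \<le> card (second_out_nbrs D x - K)"
    proof (intro card_mono subsetI)
      fix u assume "u \<in> second_out_nbrs ?G v"
      then obtain w where w: "(v, w) \<in> F" "(w, u) \<in> F" "u \<noteq> v" "(v, u) \<notin> F"
        by (auto simp: second_out_nbrs_def)
      then have V: "u \<in> V" "w \<in> V" "v \<in> V" using G.arcs_in by auto
      \<comment> \<open>For \<open>u\<close> in \<open>K\<close>: if \<open>w\<close> lies in
        \<open>K\<close>, transitivity gives \<open>(v, u) \<in> F\<close>; if not,
        \<open>v \<rightarrow> w \<rightarrow> u\<close> contradicts the interval property.\<close>
      have u: "u \<notin> K"
      proof
        assume u: "u \<in> K"
        show False
        proof (cases "w \<in> K")
          case True
          then show False using w u v F_K by fastforce
        next
          case False
          then have "(v, w) \<in> E" "(w, u) \<in> E" using w F_E by auto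
          then show False
            using interval_out[OF V(2) False u] interval_out[OF V(2) False v(1)] asym by blast
        qed
      qed
      then have E: "(w, u) \<in> E" "(v, u) \<notin> E" using w F_E by auto
      then have "w \<notin> K" using interval_out[OF V(1) u] v by blast
      then have "(x, w) \<in> E" using w F_E interval_out[OF V(2) _ v(1)] by auto
      moreover have "(x, u) \<notin> E" using E interval_out[OF V(1) u v(1)] by auto
      moreover have "u \<noteq> x" using u by (auto simp: K_def)
      ultimately show "u \<in> second_out_nbrs D x - K" using E u by (auto simp: second_out_nbrs_def E_def[symmetric])
    qed (simp add: finite_nbrs)
    finally show "card (out_nbrs D x - K) \<le> card (second_out_nbrs D x - K)" .
  qed
  show ?thesis
  proof (cases "\<exists>v\<in>V. \<forall>u. (v, u) \<notin> F")
    case True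
    then obtain v where v: "v \<in> V" "\<And>u. (v, u) \<notin> F" by blast
    have "v \<in> K"
    proof (rule ccontr)
      assume "v \<notin> K"
      then have "(v, u) \<notin> E" for u using v F_E by blast
      then have "out_arcs (with_proj D) v = {}" by (auto simp: out_arcs_def E_def)
      then have "is_sink D v" using v by (simp add: is_sink_def out_degree_def V_def)
      then show False using nosink by blast
    qed
    moreover have "second_nbhd_property ?G v" using v by (simp add: second_nbhd_property_def out_nbrs_def)
    ultimately show ?thesis by (rule inside)
  next
    case False
    then obtain u v where "u \<in> V" "v \<in> V" "u \<noteq> v" "second_nbhd_property ?G u" "second_nbhd_property ?G v"
      using G.two_second_nbhd_property verts by blast
    then show ?thesis using outside inside by blast
  qed
qed

end

section \<open>From the deleted stars to the locale\<close>

lemma two_second_nbhd_property_oriented: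
  fixes T D :: "'a pair_pre_digraph" and S1 S2 :: "'a set set" and c1 c2 :: 'a
  assumes T: "tournament T"
    and "star c1 S1" and "star c2 S2"
    and sub: "\<Union>S1 \<subseteq> pverts T" "\<Union>S2 \<subseteq> pverts T"
    and dis: "\<Union>S1 \<inter> \<Union>S2 = {}"
    and D: "D = delete_edges T (S1 \<union> S2)"
    and dep: "\<not> (\<exists>e. is_source (dependency_digraph D) e)" "\<not> (\<exists>e. is_sink (dependency_digraph D) e)"
    and sink: "\<not> (\<exists>v. is_sink D v)"
    and c: "(c1, c2) \<in> parcs T"
  shows "\<exists>u v. u \<in> pverts D \<and> v \<in> pverts D \<and> u \<noteq> v \<and>
    second_nbhd_property D u \<and> second_nbhd_property D v"
proof -
  obtain A where A: "A \<noteq> {}" "c1 \<notin> A" "S1 = (\<lambda>a. {a, c1}) ` A" using assms(2) by (auto simp: star_def)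
  obtain B where B: "B \<noteq> {}" "c2 \<notin> B" "S2 = (\<lambda>a. {a, c2}) ` B" using assms(3) by (auto simp: star_def)
  have U: "\<Union>S1 = insert c1 A" "\<Union>S2 = insert c2 B" using A B by auto
  interpret T: pair_digraph T using T by (simp add: tournament_def)
  have tot: "(u, v) \<in> parcs T \<longleftrightarrow> (v, u) \<notin> parcs T" if "u \<in> pverts T" "v \<in> pverts T" "u \<noteq> v" for u v
    using T that unfolding tournament_def by blast
  have arcs: "u \<in> pverts T \<and> v \<in> pverts T \<and> u \<noteq> v" if "(u, v) \<in> parcs T" for u v
    using T.in_arcsD1[OF that] T.in_arcsD2[OF that] T.no_loops'[OF that] by simp
  have parcs: "parcs D = {(u, v) \<in> parcs T. {u, v} \<notin> S1 \<union> S2}" and verts: "pverts D = pverts T"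
    by (simp_all add: D delete_edges_def)
  \<comment> \<open>A star edge has both ends in its star, and the centers lie in disjoint
    stars.\<close>
  have "{c1, c2} \<notin> S1 \<union> S2" using U dis A B by auto
  then have c': "(c1, c2) \<in> parcs D" using c by (simp add: parcs)
  interpret dependent_stars D c1 c2 A B "parcs D" "pverts D"
    "(\<lambda>a. {a, c1}) ` A \<union> (\<lambda>b. {b, c2}) ` B"
  proof (unfold_locales)
    show "finite (pverts D)" by (simp add: verts)
    fix u v 
    show "(u, v) \<in> parcs D \<Longrightarrow> u \<in> pverts D \<and> v \<in> pverts D" using arcs by (auto simp: parcs verts)
    show "(u, v) \<in> parcs D \<Longrightarrow> (v, u) \<notin> parcs D" using arcs tot unfolding parcs by blast
    assume "u \<in> pverts D" "v \<in> pverts D" "u \<noteq> v"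
    then show "(u, v) \<notin> parcs D \<and> (v, u) \<notin> parcs D \<longleftrightarrow> {u, v} \<in> (\<lambda>a. {a, c1}) ` A \<union> (\<lambda>b. {b, c2}) ` B"
      using tot[of u v] unfolding A(3)[symmetric] B(3)[symmetric]
      by (auto simp: parcs verts insert_commute)
  qed (use A B U sub dis dep c' in \<open>auto simp: verts\<close>)
  show ?thesis using two_second_nbhd_property[OF sink] .
qed

theorem theorem5:
  fixes T D :: "'a pair_pre_digraph" and S1 S2 :: "'a set set" and c1 c2 :: 'a
  assumes "tournament T"
    and "star c1 S1" and "star c2 S2"
    and "\<Union>S1 \<subseteq> pverts T" and "\<Union>S2 \<subseteq> pverts T"
    and "\<Union>S1 \<inter> \<Union>S2 = {}"
    and "D = delete_edges T (S1 \<union> S2)"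
    and "\<not> (\<exists>e. is_source (dependency_digraph D) e)"
    and "\<not> (\<exists>e. is_sink (dependency_digraph D) e)"
    and "\<not> (\<exists>v. is_sink D v)"
  shows "\<exists>u v. u \<in> pverts D \<and> v \<in> pverts D \<and> u \<noteq> v \<and>
    second_nbhd_property D u \<and> second_nbhd_property D v"
proof -
  have "c1 \<in> \<Union>S1" "c2 \<in> \<Union>S2" using assms(2,3) by (auto simp: star_def)
  then have "c1 \<in> pverts T" "c2 \<in> pverts T" "c1 \<noteq> c2" using assms(4-6) by auto
  \<comment> \<open>The hypotheses are symmetric in the two stars, so the stars may be exchanged to
    fix the direction between the centers.\<close>
  then consider "(c1, c2) \<in> parcs T" | "(c2, c1) \<in> parcs T"
    using assms(1) unfolding tournament_def by blast
  then show ?thesis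
  proof cases
    case 1
    then show ?thesis using two_second_nbhd_property_oriented[OF assms] by blast
  next
    case 2
    have "\<Union>S2 \<inter> \<Union>S1 = {}" "D = delete_edges T (S2 \<union> S1)" using assms(6,7) by (auto simp: Un_commute)
    from two_second_nbhd_property_oriented[OF assms(1,3,2,5,4) this assms(8-10) 2] show ?thesis .
  qed
qed

end
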